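(* For any convex body $Q$ in the plane $\mathbb{R}^2$, we have $$\mu^*_Q \le \frac{2(4-\sqrt{3})}{13}\cdot\Delta(Q) < 0.3490\cdot\Delta(Q).$$ Moreover, if $Q$ is centrally symmetric, then $\mu^*_Q\le\frac{1}{3}\cdot\Delta(Q)$.
   Context: A convex body in the plane is a compact convex subset of $\mathbb{R}^2$ with nonempty interior. For a measurable set $Q\subset\mathbb{R}^2$ with positive area and a point $p\in\mathbb{R}^2$, let $\mathrm{dist}(p,q)=|pq|$ be Euclidean distance and let $\mu_Q(p)=\frac{\int_{q\in Q}\mathrm{dist}(p,q)\,dq}{\mathrm{area}(Q)}$ be the average distance from $p$ to the points of $Q$. Let $\mu^*_Q=\min\{\mu_Q(p): p\in\mathbb{R}^2\}$ (a point attaining this minimum is a Fermat-Weber center of $Q$). $\Delta(Q)$ denotes the diameter of $Q$, i.e. the maximum Euclidean distance between two points of $Q$. $Q$ is centrally symmetric if there is a point $c\in\mathbb{R}^2$ such that $2c-q\in Q$ for every $q\in Q$. *)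

theory Defs
  imports "HOL-Analysis.Analysis"
begin

definition convex_body :: "(real^2) set \<Rightarrow> bool" where
  "convex_body Q \<longleftrightarrow> compact Q \<and> convex Q \<and> interior Q \<noteq> {}"

definition avg_dist :: "(real^2) set \<Rightarrow> real^2 \<Rightarrow> real" where
  "avg_dist Q p = (LINT q:Q|lebesgue. dist p q) / measure lebesgue Q"

text \<open>The value of \<^term>\<open>Least\<close> is meaningful only if the minimum is attained; for convex
  bodies this is lemma \<open>min_avg_dist_attained\<close> below.\<close>

definition min_avg_dist :: "(real^2) set \<Rightarrow> real" where
  "min_avg_dist Q = (LEAST m. m \<in> range (avg_dist Q))"

definition centrally_symmetric :: "(real^2) set \<Rightarrow> bool" where
  "centrally_symmetric Q \<longleftrightarrow> (\<exists>c. \<forall>q\<in>Q. 2 *\<^sub>R c - q \<in> Q)"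

lemma convex_body_measure_pos:
  assumes "convex_body Q"
  shows "measure lebesgue Q > 0"
proof -
  have "Q \<in> lmeasurable"
    using assms by (simp add: convex_body_def lmeasurable_compact)
  moreover have "\<not> negligible Q"
    using assms negligible_convex_interior[of Q] by (simp add: convex_body_def)
  ultimately show ?thesis
    using negligible_iff_measure[of Q] by (simp add: zero_less_measure_iff)
qed

lemma set_integrable_lebesgue_compact:
  fixes f :: "real^2 \<Rightarrow> real"
  assumes "compact Q" "continuous_on Q f"
  shows "set_integrable lebesgue Q f"
proof -
  have "set_integrable lborel Q f"
    using borel_integrable_compact[OF assms] by (simp add: set_integrable_def)
  then show ?thesis
    by (simp add: set_integrable_def integrable_completion borel_measurable_integrable)
qed

lemma avg_dist_mono_affine:
  assumes "convex_body Q" and "\<And>q. q \<in> Q \<Longrightarrow> t * dist p q \<le> c + s * dist p' q"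
  shows "t * avg_dist Q p \<le> c + s * avg_dist Q p'"
proof -
  have comp: "compact Q" using assms(1) by (simp add: convex_body_def)
  have Q: "Q \<in> lmeasurable" using comp by (rule lmeasurable_compact)
  have int: "set_integrable lebesgue Q (dist x)" for x
    by (intro set_integrable_lebesgue_compact comp continuous_intros)
  have intc: "set_integrable lebesgue Q (\<lambda>q. c)"
    by (intro set_integrable_lebesgue_compact comp continuous_intros)
  have "t * (LINT q:Q|lebesgue. dist p q) = (LINT q:Q|lebesgue. t * dist p q)"
    by simp
  also have "\<dots> \<le> (LINT q:Q|lebesgue. c + s * dist p' q)"
    using assms(2) by (intro set_integral_mono set_integral_add int intc set_integrable_mult_right) auto
  also have "\<dots> = (LINT q:Q|lebesgue. c) + s * (LINT q:Q|lebesgue. dist p' q)"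
    by (simp add: set_integral_add int intc)
  also have "(LINT q:Q|lebesgue. c) = c * measure lebesgue Q"
    using Q by (simp add: set_lebesgue_integral_def)
  finally show ?thesis
    using convex_body_measure_pos[OF assms(1)] by (simp add: avg_dist_def field_simps)
qed

lemma min_avg_dist_attained:
  assumes Q: "convex_body Q"
  obtains p where "avg_dist Q p = min_avg_dist Q" "\<And>p'. min_avg_dist Q \<le> avg_dist Q p'"
proof -
  obtain q0 where q0: "q0 \<in> Q"
    using Q interior_subset by (fastforce simp: convex_body_def)
  define R where "R = diameter Q"
  have R: "dist q0 q \<le> R" if "q \<in> Q" for q
    using Q q0 that by (simp add: R_def convex_body_def compact_imp_bounded diameter_bounded_bound)
  have R0: "R \<ge> 0" using R[OF q0] by simp
  have lip: "avg_dist Q p \<le> dist p p' + avg_dist Q p'" for p p'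
    using avg_dist_mono_affine[OF Q, of 1 p "dist p p'" 1 p'] by (simp add: dist_triangle)
  have upper: "avg_dist Q q0 \<le> R"
    using avg_dist_mono_affine[OF Q, of 1 q0 R 0 q0] R by simp
  have lower: "dist p q0 - R \<le> avg_dist Q p" for p
  proof -
    have "0 * dist q0 q \<le> (R - dist p q0) + 1 * dist p q" if "q \<in> Q" for q
      using R[OF that] dist_triangle[of p q0 q] by (simp add: dist_commute)
    then show ?thesis
      using avg_dist_mono_affine[OF Q, of 0 q0 "R - dist p q0" 1 p] by simp
  qed
  have cont: "continuous_on (cball q0 (2*R)) (avg_dist Q)"
  proof (rule lipschitz_on_continuous_on)
    show "1-lipschitz_on (cball q0 (2*R)) (avg_dist Q)"
    proof (rule lipschitz_onI)
      fix x y
      show "dist (avg_dist Q x) (avg_dist Q y) \<le> 1 * dist x y"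
        using lip[of x y] lip[of y x] by (simp add: dist_real_def dist_commute abs_le_iff)
    qed simp
  qed
  obtain p where p: "p \<in> cball q0 (2*R)" "\<And>y. y \<in> cball q0 (2*R) \<Longrightarrow> avg_dist Q p \<le> avg_dist Q y"
    using continuous_attains_inf[OF compact_cball _ cont] R0 by fastforce
  have min: "avg_dist Q p \<le> avg_dist Q y" for y
  proof (cases "y \<in> cball q0 (2*R)")
    case False
    then have "R < avg_dist Q y"
      using lower[of y] by (simp add: dist_commute)
    moreover have "avg_dist Q p \<le> avg_dist Q q0" using p(2) R0 by simp
    ultimately show ?thesis using upper by simp
  qed (rule p)
  have "min_avg_dist Q = avg_dist Q p"
    unfolding min_avg_dist_def by (rule Least_equality) (use min in auto)
  with min that show thesis by auto
qed

end

theory Submission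
  imports Defs
begin

text \<open>
  Let \<open>p\<close> be a point of \<open>Q\<close>, and let a chord through \<open>p\<close> be cut by \<open>p\<close> into halves of lengths \<open>a\<close> and
  \<open>b\<close>. In polar coordinates about \<open>p\<close>, a thin double sector around this chord contributes to the
  integral of the distance and to the area in the ratio \<open>2 * (a ^ 3 + b ^ 3)\<close> to
  \<open>3 * (a\<^sup>2 + b\<^sup>2)\<close>. Hence the average distance from \<open>p\<close> is at most \<open>k\<close> as soon as this ratio is at
  most \<open>k\<close> for each chord (lemma \<open>avg_dist_le_of_chords\<close>). Polar coordinates are replaced there by an
  averaging over homotheties, lemma \<open>nn_integral_over_chords\<close>.

  If \<open>Q\<close> is centrally symmetric about \<open>p\<close>, then \<open>a = b\<close> and \<open>a + b\<close> is at most the diameter \<open>D\<close>, so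
  the ratio is \<open>2 * a / 3 \<le> D / 3\<close>.

  In general \<open>p\<close> is taken to be the centre of the smallest enclosing disc, with radius \<open>R\<close>. Besides
  \<open>a + b \<le> D\<close>, two facts restrict the chords. Jung's inequality \<open>3 * R\<^sup>2 \<le> D\<^sup>2\<close> bounds the
  longer half. This alone does not suffice, because a long half could be paired with a very short
  one, where the ratio is close to \<open>2 * a / 3\<close>. But \<open>Q\<close> touches the circle in points that surround
  \<open>p\<close> and have mutual distances at most \<open>D\<close>; the supporting line of \<open>Q\<close> at the end of the
  shorter half, whose distance from \<open>p\<close> is at most \<open>b\<close>, therefore cuts the circle in a chord of length
  at most \<open>D\<close>, so \<open>R\<^sup>2 - b\<^sup>2 \<le> D\<^sup>2 / 4\<close>, and the shorter half cannot be
  too short (lemma \<open>chord_through_circumcenter\<close>). Under these constraints the ratio is maximal for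
  \<open>a = D / sqrt 3\<close> and \<open>b = D - a\<close>, which yields the constant of the theorem
  (lemma \<open>cubic_chord_bound\<close>).
\<close>

section \<open>Integration along the lines through a point\<close>

lemma nn_integral_homothety:
  fixes f :: "'a::euclidean_space \<Rightarrow> ennreal"
  assumes [measurable]: "f \<in> borel_measurable borel" and "c \<noteq> 0"
  shows "(\<integral>\<^sup>+x. f x \<partial>lborel) = ennreal (\<bar>c\<bar> ^ DIM('a)) * (\<integral>\<^sup>+x. f (t + c *\<^sub>R x) \<partial>lborel)"
  by (subst lborel_affine[OF \<open>c \<noteq> 0\<close>, of t])
     (simp add: nn_integral_density nn_integral_distr nn_integral_cmult)

text \<open>Any function of \<open>norm y\<close> could serve as the weight in the averaging formula below, as long as the
  total weight that it gives to a point is finite and positive. With this choice the point \<open>x\<close> is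
  met for the parameters \<open>\<bar>s\<bar> \<le> norm (x - p)\<close>, each with weight \<open>1 / norm (x - p)\<close>, so that the
  total is \<open>2\<close> for every \<open>x \<noteq> p\<close>.\<close>
definition chord_weight :: "'a::euclidean_space \<Rightarrow> real" where
  "chord_weight y = (if norm y < 1 then 0 else 1 / norm y)"

lemma borel_measurable_chord_weight [measurable]: "chord_weight \<in> borel_measurable borel"
  unfolding chord_weight_def[abs_def] by measurable

text \<open>A substitute for polar coordinates that needs only homotheties and Tonelli's theorem: every
  integral is an average of integrals along whole lines through \<open>p\<close>, with the Jacobian of polar
  coordinates as density. For fixed \<open>s \<noteq> 0\<close> the substitution \<open>x = p + s *\<^sub>R y\<close> turns the inner integral
  over \<open>y\<close> into an integral of \<open>f x\<close> with a weight depending on \<open>s\<close> and \<open>norm (x - p)\<close>, and that weight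
  integrates to \<open>2\<close> over \<open>s\<close>. Letting \<open>s\<close> run through negative values as well is what later puts
  the two halves of a chord into a single integral.\<close>
lemma nn_integral_over_chords:
  fixes f :: "'a::euclidean_space \<Rightarrow> ennreal"
  assumes f[measurable]: "f \<in> borel_measurable borel"
  shows "(\<integral>\<^sup>+y. \<integral>\<^sup>+s. ennreal (chord_weight y * \<bar>s\<bar> ^ (DIM('a) - 1)) * f (p + s *\<^sub>R y)
            \<partial>lborel \<partial>lborel)
       = 2 * (\<integral>\<^sup>+x. f x \<partial>lborel)"
proof -
  define n where "n = DIM('a) - 1"
  have n: "DIM('a) = Suc n"
    using DIM_positive[where 'a='a] by (simp add: n_def)
  have slice: "(\<integral>\<^sup>+y. ennreal (chord_weight y * \<bar>s\<bar> ^ n) * f (p + s *\<^sub>R y) \<partial>lborel)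
      = (\<integral>\<^sup>+x. ennreal (if \<bar>s\<bar> \<le> norm (x - p) then 1 / norm (x - p) else 0) * f x \<partial>lborel)"
    if s: "s \<noteq> 0" for s :: real
  proof -
    have eq: "ennreal (if \<bar>s\<bar> \<le> norm (s *\<^sub>R y) then 1 / norm (s *\<^sub>R y) else 0)
        = ennreal (1 / \<bar>s\<bar> ^ Suc n) * ennreal (chord_weight y * \<bar>s\<bar> ^ n)" for y :: 'a
    proof -
      have "\<bar>s\<bar> \<le> norm (s *\<^sub>R y) \<longleftrightarrow> \<bar>s\<bar> * 1 \<le> \<bar>s\<bar> * norm y"
        by simp
      also have "\<dots> \<longleftrightarrow> 1 \<le> norm y"
        using s by (subst mult_le_cancel_left_pos) auto
      finally have "(if \<bar>s\<bar> \<le> norm (s *\<^sub>R y) then 1 / norm (s *\<^sub>R y) else 0)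
          = (1 / \<bar>s\<bar> ^ Suc n) * (chord_weight y * \<bar>s\<bar> ^ n)"
        using s by (auto simp: chord_weight_def field_simps)
      then show ?thesis
        by (simp only: ennreal_mult' divide_nonneg_nonneg zero_le_one zero_le_power abs_ge_zero)
    qed
    have "(\<integral>\<^sup>+x. ennreal (if \<bar>s\<bar> \<le> norm (x - p) then 1 / norm (x - p) else 0) * f x \<partial>lborel)
      = ennreal (\<bar>s\<bar> ^ Suc n) * (\<integral>\<^sup>+y. ennreal (1 / \<bar>s\<bar> ^ Suc n) * (ennreal (chord_weight y * \<bar>s\<bar> ^ n) * f (p + s *\<^sub>R y)) \<partial>lborel)"
      by (subst nn_integral_homothety[OF _ s, where t = p])
         (measurable, simp only: add_diff_cancel_left' eq n mult.assoc)
    also have "\<dots> = ennreal (\<bar>s\<bar> ^ Suc n) * ennreal (1 / \<bar>s\<bar> ^ Suc n) *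
        (\<integral>\<^sup>+y. ennreal (chord_weight y * \<bar>s\<bar> ^ n) * f (p + s *\<^sub>R y) \<partial>lborel)"
      by (subst nn_integral_cmult) (auto simp: mult.assoc)
    also have "ennreal (\<bar>s\<bar> ^ Suc n) * ennreal (1 / \<bar>s\<bar> ^ Suc n) = 1"
      using s by (simp flip: ennreal_mult)
    finally show ?thesis by simp
  qed
  have "(\<integral>\<^sup>+y. \<integral>\<^sup>+s. ennreal (chord_weight y * \<bar>s\<bar> ^ n) * f (p + s *\<^sub>R y) \<partial>lborel \<partial>lborel)
      = (\<integral>\<^sup>+s. \<integral>\<^sup>+y. ennreal (chord_weight y * \<bar>s\<bar> ^ n) * f (p + s *\<^sub>R y) \<partial>lborel \<partial>lborel)"
    by (rule lborel_pair.Fubini') measurable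
  also have "\<dots> = (\<integral>\<^sup>+s. \<integral>\<^sup>+x. ennreal (if \<bar>s\<bar> \<le> norm (x - p) then 1 / norm (x - p) else 0) * f x
      \<partial>lborel \<partial>lborel)"
    using AE_lborel_singleton[of "0::real"]
    by (intro nn_integral_cong_AE) (auto elim!: eventually_mono simp: slice)
  also have "\<dots> = (\<integral>\<^sup>+x. \<integral>\<^sup>+s. ennreal (if \<bar>s\<bar> \<le> norm (x - p) then 1 / norm (x - p) else 0) * f x
      \<partial>lborel \<partial>lborel)"
    by (rule lborel_pair.Fubini') measurable
  also have "\<dots> = (\<integral>\<^sup>+x. 2 * f x \<partial>lborel)"
  proof (intro nn_integral_cong_AE, use AE_lborel_singleton[of p] in eventually_elim)
    case (elim x)
    let ?r = "norm (x - p)"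
    have r: "?r > 0" using elim by simp
    have "(\<integral>\<^sup>+s. ennreal (if \<bar>s\<bar> \<le> ?r then 1 / ?r else 0) * f x \<partial>lborel)
        = (\<integral>\<^sup>+s. (ennreal (1 / ?r) * f x) * indicator {- ?r..?r} s \<partial>lborel)"
      by (intro nn_integral_cong) (auto simp: indicator_def)
    also have "\<dots> = ennreal (1 / ?r) * f x * ennreal (2 * ?r)"
      by (subst nn_integral_cmult_indicator) auto
    also have "\<dots> = (ennreal (1 / ?r) * ennreal (2 * ?r)) * f x"
      by (simp add: mult_ac)
    also have "ennreal (1 / ?r) * ennreal (2 * ?r) = ennreal (1 / ?r * (2 * ?r))"
      using r by (intro ennreal_mult[symmetric]) auto
    also have "1 / ?r * (2 * ?r) = 2"
      using r by simp
    finally show ?case by simp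
  qed
  also have "\<dots> = 2 * (\<integral>\<^sup>+x. f x \<partial>lborel)"
    by (rule nn_integral_cmult) measurable
  finally show ?thesis by (simp only: n_def)
qed

lemma DERIV_mult_abs: "((\<lambda>s::real. s * \<bar>s\<bar> / 2) has_real_derivative \<bar>s\<bar>) (at s)"
proof (cases "s = 0")
  case True
  have "((\<lambda>h::real. \<bar>h\<bar> / 2) \<longlongrightarrow> 0) (at 0)"
    by (auto intro!: tendsto_eq_intros)
  then have "((\<lambda>h::real. h * \<bar>h\<bar> / 2 / h) \<longlongrightarrow> 0) (at 0)"
    by (rule Lim_transform_eventually) (auto simp: eventually_at_filter)
  then show ?thesis using True by (simp add: has_field_derivative_iff)
next
  case False
  have "((\<lambda>x. sgn s * x\<^sup>2 / 2) has_real_derivative \<bar>s\<bar>) (at s)"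
    by (auto intro!: derivative_eq_intros simp: sgn_if)
  then show ?thesis
  proof (rule has_field_derivative_transform_within_open)
    show "open {x. 0 < sgn s * x}"
      by (intro open_Collect_less continuous_intros)
  qed (use False in \<open>auto simp: sgn_if power2_eq_square split: if_splits\<close>)
qed

lemma nn_integral_abs_Icc:
  assumes "a \<ge> 0" "b \<ge> 0"
  shows "(\<integral>\<^sup>+s. ennreal \<bar>s\<bar> * indicator {- b..a} s \<partial>lborel) = ennreal ((a\<^sup>2 + b\<^sup>2) / 2)"
  using nn_integral_FTC_Icc[of abs "- b" a "\<lambda>s. s * \<bar>s\<bar> / 2"] DERIV_mult_abs assms
  by (simp add: power2_eq_square add_divide_distrib)

lemma nn_integral_power2_Icc:
  fixes a b :: real
  assumes "a \<ge> 0" "b \<ge> 0"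
  shows "(\<integral>\<^sup>+s. ennreal (s\<^sup>2) * indicator {- b..a} s \<partial>lborel) = ennreal ((a ^ 3 + b ^ 3) / 3)"
proof -
  have "((\<lambda>s. s ^ 3 / 3) has_real_derivative s\<^sup>2) (at s)" for s :: real
    by (auto intro!: derivative_eq_intros)
  then show ?thesis
    using nn_integral_FTC_Icc[of "\<lambda>s. s\<^sup>2" "- b" a "\<lambda>s. s ^ 3 / 3"] assms
    by (simp add: add_divide_distrib del: ennreal_plus)
qed

text \<open>The two-dimensional estimate is reduced to one inequality per chord through \<open>p\<close>. On the line
  through \<open>p\<close> with direction \<open>u\<close>, the density \<open>\<bar>s\<bar>\<close> gives the distance integral \<open>(a ^ 3 + b ^ 3) / 3\<close> and the area
  \<open>(a\<^sup>2 + b\<^sup>2) / 2\<close>; the hypothesis says that their quotient is at most \<open>k\<close>, and this survives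
  averaging over all lines.\<close>
lemma avg_dist_le_of_chords:
  assumes Q: "convex_body Q" and p: "p \<in> Q" and k: "k \<ge> 0"
    and chord: "\<And>u a b. norm u = 1 \<Longrightarrow> a \<ge> 0 \<Longrightarrow> b \<ge> 0 \<Longrightarrow> {s. p + s *\<^sub>R u \<in> Q} = {- b..a} \<Longrightarrow>
      2 * (a ^ 3 + b ^ 3) \<le> 3 * k * (a\<^sup>2 + b\<^sup>2)"
  shows "avg_dist Q p \<le> k"
proof -
  have comp: "compact Q" and conv: "convex Q" using Q by (auto simp: convex_body_def)
  have [measurable]: "Q \<in> sets borel" using comp by (rule borel_compact)
  have chord_y: "(\<integral>\<^sup>+s. ennreal (chord_weight y * \<bar>s\<bar>) *
        (ennreal (dist p (p + s *\<^sub>R y)) * indicator Q (p + s *\<^sub>R y)) \<partial>lborel)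
     \<le> (\<integral>\<^sup>+s. ennreal (chord_weight y * \<bar>s\<bar>) *
        (ennreal k * indicator Q (p + s *\<^sub>R y)) \<partial>lborel)" for y :: "real^2"
  proof (cases "norm y < 1")
    case True
    then show ?thesis by (simp add: chord_weight_def)
  next
    case False
    define m where "m = norm y"
    have m: "m \<ge> 1" using False by (simp add: m_def)
    define u where "u = y /\<^sub>R m"
    have u: "norm u = 1" "y = m *\<^sub>R u" using m by (auto simp: u_def m_def[symmetric])
    let ?I = "\<lambda>w. {s. p + s *\<^sub>R w \<in> Q}"
    obtain c a where ca: "?I u = {c..a}"
    proof -
      have "closed (?I u)"
        using continuous_closed_vimage[of Q "\<lambda>s. p + s *\<^sub>R u"] comp
        by (auto simp: vimage_def compact_imp_closed intro!: continuous_intros)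
      moreover have "bounded (?I u)"
      proof -
        obtain r where r: "\<And>q. q \<in> Q \<Longrightarrow> dist p q \<le> r"
          using comp by (meson bounded_any_center compact_imp_bounded)
        show ?thesis
          unfolding bounded_def
          by (rule exI[of _ 0], rule exI[of _ r]) (use r u in \<open>force simp: dist_norm\<close>)
      qed
      moreover have "convex (?I u)"
      proof (rule convexI)
        fix x y v w :: real
        assume *: "x \<in> ?I u" "y \<in> ?I u" "0 \<le> v" "0 \<le> w" "v + w = 1"
        have "v *\<^sub>R (p + x *\<^sub>R u) + w *\<^sub>R (p + y *\<^sub>R u) \<in> Q"
          using * by (intro convexD[OF conv]) auto
        also have "v *\<^sub>R (p + x *\<^sub>R u) + w *\<^sub>R (p + y *\<^sub>R u) = (v + w) *\<^sub>R p + (v *\<^sub>R x + w *\<^sub>R y) *\<^sub>R u"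
          by (simp add: algebra_simps)
        finally show "v *\<^sub>R x + w *\<^sub>R y \<in> ?I u" using * by simp
      qed
      ultimately have "\<exists>c a. ?I u = {c..a}"
        using connected_compact_interval_1[of "?I u"] by (simp add: compact_eq_bounded_closed convex_connected)
      then show thesis using that by blast
    qed
    define b where "b = - c"
    have "0 \<in> ?I u" using p by simp
    then have ab: "a \<ge> 0" "b \<ge> 0" unfolding ca b_def by auto
    have ineq: "2 * (a ^ 3 + b ^ 3) \<le> 3 * k * (a\<^sup>2 + b\<^sup>2)"
      using chord[of u a b] u ab ca by (simp add: b_def)
    \<comment> \<open>The line is parametrised by \<open>y = m *\<^sub>R u\<close>, which shrinks the parameter interval by \<open>m\<close>.\<close>
    have mem: "p + s *\<^sub>R y \<in> Q \<longleftrightarrow> s \<in> {- (b / m)..a / m}" for s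
    proof -
      have "p + s *\<^sub>R y \<in> Q \<longleftrightarrow> s * m \<in> ?I u" by (simp add: u)
      also have "\<dots> \<longleftrightarrow> s \<in> {- (b / m)..a / m}" unfolding ca b_def using m by (simp add: field_simps)
      finally show ?thesis .
    qed
    have "(\<integral>\<^sup>+s. ennreal (chord_weight y * \<bar>s\<bar>) *
        (ennreal (dist p (p + s *\<^sub>R y)) * indicator Q (p + s *\<^sub>R y)) \<partial>lborel)
      = (\<integral>\<^sup>+s. ennreal (s\<^sup>2) * indicator {- (b / m)..a / m} s \<partial>lborel)"
      using m mem by (intro nn_integral_cong)
        (auto simp: indicator_def chord_weight_def m_def[symmetric] dist_norm power2_eq_square simp flip: ennreal_mult)
    also have "\<dots> = ennreal (((a / m) ^ 3 + (b / m) ^ 3) / 3)"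
      using ab m by (intro nn_integral_power2_Icc) auto
    also have "\<dots> \<le> ennreal (k / m * (((a / m)\<^sup>2 + (b / m)\<^sup>2) / 2))"
    proof (rule ennreal_leI)
      have "((a / m) ^ 3 + (b / m) ^ 3) / 3 = 2 * (a ^ 3 + b ^ 3) / (6 * m ^ 3)"
        using m by (simp add: field_simps)
      also have "\<dots> \<le> 3 * k * (a\<^sup>2 + b\<^sup>2) / (6 * m ^ 3)"
        using m by (intro divide_right_mono ineq) auto
      also have "\<dots> = k / m * (((a / m)\<^sup>2 + (b / m)\<^sup>2) / 2)"
        using m by (simp add: field_simps power2_eq_square power3_eq_cube)
      finally show "((a / m) ^ 3 + (b / m) ^ 3) / 3 \<le> k / m * (((a / m)\<^sup>2 + (b / m)\<^sup>2) / 2)" .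
    qed
    also have "\<dots> = ennreal (k / m) * (\<integral>\<^sup>+s. ennreal \<bar>s\<bar> * indicator {- (b / m)..a / m} s \<partial>lborel)"
      using ab m k by (subst nn_integral_abs_Icc) (auto simp flip: ennreal_mult)
    also have "\<dots> = (\<integral>\<^sup>+s. ennreal (k / m) * (ennreal \<bar>s\<bar> * indicator {- (b / m)..a / m} s) \<partial>lborel)"
      by (rule nn_integral_cmult[symmetric]) measurable
    also have "\<dots> = (\<integral>\<^sup>+s. ennreal (chord_weight y * \<bar>s\<bar>) *
        (ennreal k * indicator Q (p + s *\<^sub>R y)) \<partial>lborel)"
      using m mem k by (intro nn_integral_cong)
        (auto simp: indicator_def chord_weight_def m_def[symmetric] mult_ac simp flip: ennreal_mult)
    finally show ?thesis .
  qed
  have "2 * (\<integral>\<^sup>+x. ennreal (dist p x) * indicator Q x \<partial>lborel)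
      \<le> 2 * (\<integral>\<^sup>+x. ennreal k * indicator Q x \<partial>lborel)"
    by (subst (1 2) nn_integral_over_chords[of _ p, symmetric])
       (measurable, simp, intro nn_integral_mono chord_y)
  then have "(\<integral>\<^sup>+x. ennreal (dist p x) * indicator Q x \<partial>lborel)
      \<le> ennreal k * emeasure lborel Q"
    by (simp add: ennreal_mult_le_mult_iff nn_integral_cmult_indicator)
  also have "emeasure lborel Q = ennreal (measure lebesgue Q)"
    using emeasure_compact_finite[OF comp] by (simp add: measure_def)
  also have "ennreal k * \<dots> = ennreal (k * measure lebesgue Q)"
    using k by (simp add: ennreal_mult)
  finally have "(\<integral>\<^sup>+x. ennreal (dist p x) * indicator Q x \<partial>lborel) \<le> ennreal (k * measure lebesgue Q)" .
  moreover have "(\<integral>\<^sup>+x. ennreal (dist p x) * indicator Q x \<partial>lborel)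
      = ennreal (LINT q:Q|lebesgue. dist p q)"
  proof -
    have "integrable lebesgue (\<lambda>x. indicator Q x *\<^sub>R dist p x)"
      using set_integrable_lebesgue_compact[OF comp, of "dist p"]
      by (simp add: set_integrable_def continuous_intros)
    then have "(\<integral>\<^sup>+x. ennreal (indicator Q x *\<^sub>R dist p x) \<partial>lebesgue)
        = ennreal (LINT q:Q|lebesgue. dist p q)"
      unfolding set_lebesgue_integral_def by (intro nn_integral_eq_integral) auto
    moreover have "(\<integral>\<^sup>+x. ennreal (indicator Q x *\<^sub>R dist p x) \<partial>lebesgue)
        = (\<integral>\<^sup>+x. ennreal (dist p x) * indicator Q x \<partial>lborel)"
      unfolding nn_integral_completion by (intro nn_integral_cong) (auto simp: indicator_def)
    ultimately show ?thesis by simp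
  qed
  ultimately have "(LINT q:Q|lebesgue. dist p q) \<le> k * measure lebesgue Q"
    using k by (simp add: ennreal_le_iff)
  then show ?thesis
    using convex_body_measure_pos[OF Q] by (simp add: avg_dist_def field_simps)
qed

section \<open>The smallest enclosing disc\<close>

text \<open>The distance to the farthest point of \<open>Q\<close> is a Lipschitz function of the centre, and outside a
  ball around a point \<open>q0\<close> of \<open>Q\<close> it exceeds its value at \<open>q0\<close>; so it has a minimum.\<close>
lemma smallest_enclosing_ball_exists:
  fixes Q :: "'a::euclidean_space set"
  assumes Q: "compact Q" "Q \<noteq> {}"
  obtains p R where "\<And>q. q \<in> Q \<Longrightarrow> dist p q \<le> R" "\<And>x. \<exists>q\<in>Q. R \<le> dist x q"
proof -
  define f where "f x = (SUP q\<in>Q. dist x q)" for x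
  have far: "\<exists>m\<in>Q. f x = dist x m \<and> (\<forall>q\<in>Q. dist x q \<le> f x)" for x
  proof -
    obtain m where m: "m \<in> Q" "\<And>q. q \<in> Q \<Longrightarrow> dist x q \<le> dist x m"
      using continuous_attains_sup[OF Q, of "dist x"] continuous_on_dist[OF continuous_on_const continuous_on_id] by blast
    then have "f x = dist x m" unfolding f_def by (intro cSup_eq_maximum) auto
    with m show ?thesis by auto
  qed
  have lip: "f x \<le> dist x y + f y" for x y
  proof -
    obtain m where m: "m \<in> Q" "f x = dist x m" using far by blast
    have "dist x m \<le> dist x y + dist y m" by (rule dist_triangle)
    moreover have "dist y m \<le> f y" using far m(1) by blast
    ultimately show ?thesis using m(2) by simp
  qed
  obtain q0 where q0: "q0 \<in> Q" using Q by auto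
  have f0: "f q0 \<ge> 0" using far[of q0] by auto
  have cont: "continuous_on (cball q0 (f q0)) f"
  proof (rule lipschitz_on_continuous_on[of 1], rule lipschitz_onI)
    fix x y
    show "dist (f x) (f y) \<le> 1 * dist x y"
      using lip[of x y] lip[of y x] by (simp add: dist_real_def dist_commute abs_le_iff)
  qed simp
  obtain p where p: "p \<in> cball q0 (f q0)" "\<And>y. y \<in> cball q0 (f q0) \<Longrightarrow> f p \<le> f y"
    using continuous_attains_inf[OF compact_cball _ cont] f0 by fastforce
  have min: "f p \<le> f y" for y
  proof (cases "y \<in> cball q0 (f q0)")
    case False
    have "f p \<le> f q0" using p(2) f0 by simp
    also have "\<dots> \<le> dist y q0" using False by (simp add: dist_commute)
    also have "\<dots> \<le> f y" using far[of y] q0 by auto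
    finally show ?thesis .
  qed (rule p)
  show thesis
  proof
    show "dist p q \<le> f p" if "q \<in> Q" for q using far that by auto
    show "\<exists>q\<in>Q. f p \<le> dist x q" for x using far[of x] min[of x] by fastforce
  qed
qed

text \<open>The radius \<open>R\<close> cannot be improved by moving the centre \<open>p\<close> slightly in the direction \<open>- w\<close>. After
  such a move some point of \<open>Q\<close> still has distance at least \<open>R\<close>, and this point lies almost on the side
  \<open>w\<close> of \<open>p\<close>. A limit of these points, as the length of the move tends to \<open>0\<close>, is a contact point
  in the closed half-space. This is the statement that \<open>p\<close> is in the convex hull of the contact
  points, in the form in which it is used.\<close>
lemma farthest_points_surround_optimum:
  fixes Q :: "'a::euclidean_space set"
  assumes Q: "compact Q" "Q \<noteq> {}"
    and R: "\<And>q. q \<in> Q \<Longrightarrow> dist p q \<le> R"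
    and opt: "\<And>x. \<exists>q\<in>Q. R \<le> dist x q"
  obtains q where "q \<in> Q" "dist p q = R" "0 \<le> (q - p) \<bullet> w"
proof -
  define e where "e n = 1 / real (Suc n)" for n
  have e0: "e n > 0" for n by (simp add: e_def)
  have "\<exists>q\<in>Q. R \<le> dist (p - e n *\<^sub>R w) q" for n by (rule opt)
  then obtain q where q: "\<And>n. q n \<in> Q" "\<And>n. R \<le> dist (p - e n *\<^sub>R w) (q n)" by metis
  obtain l r where l: "l \<in> Q" and r: "strict_mono r" and lim: "(q \<circ> r) \<longlonglongrightarrow> l"
    using compact_imp_seq_compact[OF Q(1)] q(1) by (meson seq_compactE)
  have elim: "(e \<circ> r) \<longlonglongrightarrow> 0"
  proof (rule LIMSEQ_subseq_LIMSEQ[OF _ r])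
    show "e \<longlonglongrightarrow> 0"
      using LIMSEQ_Suc[OF lim_1_over_n[where 'a=real]] by (simp add: e_def[abs_def])
  qed
  have "R \<le> dist (p - 0 *\<^sub>R w) l"
  proof (rule LIMSEQ_le_const)
    show "(\<lambda>n. dist (p - (e \<circ> r) n *\<^sub>R w) ((q \<circ> r) n)) \<longlonglongrightarrow> dist (p - 0 *\<^sub>R w) l"
      by (intro tendsto_intros elim lim)
  qed (use q in auto)
  then have eq: "dist p l = R" using R[OF l] by simp
  have "0 \<le> 2 * ((q n - p) \<bullet> w) + e n * (w \<bullet> w)" for n
  proof -
    have R0: "R \<ge> 0" using eq by auto
    have "(dist p (q n))\<^sup>2 \<le> R\<^sup>2" using R[OF q(1)] by (intro power_mono) auto
    also have "\<dots> \<le> (dist (p - e n *\<^sub>R w) (q n))\<^sup>2" using q(2) R0 by (intro power_mono) auto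
    finally have "0 \<le> (dist (q n) (p - e n *\<^sub>R w))\<^sup>2 - (dist (q n) p)\<^sup>2" by (simp add: dist_commute)
    also have "\<dots> = e n * (2 * ((q n - p) \<bullet> w) + e n * (w \<bullet> w))"
      by (simp add: dist_norm power2_norm_eq_inner inner_simps inner_commute algebra_simps)
    finally show ?thesis using e0[of n] by (simp add: zero_le_mult_iff)
  qed
  moreover have "(\<lambda>n. 2 * (((q \<circ> r) n - p) \<bullet> w) + (e \<circ> r) n * (w \<bullet> w)) \<longlonglongrightarrow> 2 * ((l - p) \<bullet> w) + 0 * (w \<bullet> w)"
    by (intro tendsto_intros elim lim)
  ultimately have "0 \<le> 2 * ((l - p) \<bullet> w) + 0 * (w \<bullet> w)"
    by (intro LIMSEQ_le_const) auto
  with l eq that show thesis by simp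
qed

text \<open>A hyperplane separating \<open>p\<close> from \<open>Q\<close> would leave all contact points on one open side of \<open>p\<close>.\<close>
lemma smallest_enclosing_center_in:
  fixes Q :: "'a::euclidean_space set"
  assumes Q: "compact Q" "convex Q" "Q \<noteq> {}"
    and far: "\<And>q. q \<in> Q \<Longrightarrow> dist p q \<le> R" and opt: "\<And>x. \<exists>q\<in>Q. R \<le> dist x q"
  shows "p \<in> Q"
proof (rule ccontr)
  assume "p \<notin> Q"
  then obtain w r where w: "w \<bullet> p < r" "\<And>x. x \<in> Q \<Longrightarrow> r < w \<bullet> x"
    using separating_hyperplane_closed_point[OF Q(2) compact_imp_closed[OF Q(1)]] by blast
  obtain q where "q \<in> Q" "0 \<le> (q - p) \<bullet> (- w)"
    using farthest_points_surround_optimum[OF Q(1,3) far opt] by blast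
  then show False using w(1) w(2)[of q] by (simp add: inner_diff_right inner_commute[of _ w])
qed

definition quarter_turn :: "real^2 \<Rightarrow> real^2" where
  "quarter_turn v = vector [- v $ 2, v $ 1]"

lemma norm_sq_quarter_turn_decomposition:
  assumes "norm v = 1"
  shows "(x \<bullet> quarter_turn v)\<^sup>2 + (x \<bullet> v)\<^sup>2 = (norm x)\<^sup>2"
proof -
  have "(x \<bullet> quarter_turn v)\<^sup>2 + (x \<bullet> v)\<^sup>2 = (x \<bullet> x) * (v \<bullet> v)"
    by (simp add: quarter_turn_def inner_vec_def sum_2 algebra_simps power2_eq_square)
  moreover have "v \<bullet> v = 1" using assms by (simp add: norm_eq_1)
  ultimately show ?thesis by (simp add: power2_norm_eq_inner)
qed

text \<open>On the circle through \<open>(c, b)\<close> centred at the origin, the half-plane bounded by the diameter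
  through \<open>(c, b)\<close> cuts out a half-circle running counterclockwise from \<open>(c, b)\<close> to \<open>(- c, - b)\<close>. The
  part of it strictly below height \<open>b\<close> is the arc from \<open>(- c, b)\<close> to \<open>(- c, - b)\<close>. If \<open>y < b\<close> were
  weakened to \<open>y \<le> b\<close>, the endpoint \<open>(c, b)\<close> would remain and the conclusion would fail.\<close>
lemma arc_below_chord:
  fixes x y b c :: real
  assumes xy: "x\<^sup>2 + y\<^sup>2 = b\<^sup>2 + c\<^sup>2" and b: "b > 0" and c: "c > 0" and y: "y < b"
    and side: "b * x \<le> c * y"
  shows "x \<le> - c"
proof (rule ccontr)
  assume n: "\<not> x \<le> - c"
  have "- b < y"
  proof (rule ccontr)
    assume "\<not> - b < y"
    then have "c * y \<le> c * (- b)" using c by (intro mult_left_mono) auto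
    moreover have "b * (- c) < b * x" using n b by (intro mult_strict_left_mono) auto
    ultimately show False using side by (simp add: mult.commute)
  qed
  then have "\<bar>y\<bar>\<^sup>2 < b\<^sup>2" using y by (intro power_strict_mono) auto
  then have x2: "c\<^sup>2 < x\<^sup>2" using xy by simp
  have "c < x"
  proof (rule ccontr)
    assume "\<not> c < x"
    then have "\<bar>x\<bar>\<^sup>2 \<le> c\<^sup>2" using n c by (intro power_mono) auto
    then show False using x2 by simp
  qed
  then have "b * c < c * y" using side mult_strict_left_mono[OF _ b, of c x] by linarith
  then show False using y c by (simp add: mult.commute)
qed

text \<open>If all points of a set surrounding the centre of its circle stay below a line at distance \<open>b\<close>
  from the centre, then the set is wide: applying the surrounding property to the two half-planes
  whose boundaries join the centre to the endpoints of the cut-off chord yields one point on either side,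
  at horizontal distance at least the length \<open>2 * sqrt (R\<^sup>2 - b\<^sup>2)\<close> of that chord.\<close>
lemma surrounding_points_chord_bound:
  fixes S :: "(real^2) set"
  assumes on: "\<And>s. s \<in> S \<Longrightarrow> dist p s = R"
    and sur: "\<And>w. \<exists>s\<in>S. 0 \<le> (s - p) \<bullet> w"
    and diam: "\<And>s t. s \<in> S \<Longrightarrow> t \<in> S \<Longrightarrow> dist s t \<le> D"
    and v: "norm v = 1" and b: "\<And>s. s \<in> S \<Longrightarrow> (s - p) \<bullet> v < b"
  shows "4 * (R\<^sup>2 - b\<^sup>2) \<le> D\<^sup>2"
proof (cases "R\<^sup>2 \<le> b\<^sup>2")
  case True
  then have "4 * (R\<^sup>2 - b\<^sup>2) \<le> 0" by simp
  also have "0 \<le> D\<^sup>2" by simp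
  finally show ?thesis .
next
  case False
  define c where "c = sqrt (R\<^sup>2 - b\<^sup>2)"
  have c: "c > 0" "c\<^sup>2 = R\<^sup>2 - b\<^sup>2" using False by (auto simp: c_def)
  have b0: "b > 0" using sur[of v] b by fastforce
  let ?J = "quarter_turn v"
  have circle: "((s - p) \<bullet> ?J)\<^sup>2 + ((s - p) \<bullet> v)\<^sup>2 = b\<^sup>2 + c\<^sup>2" if "s \<in> S" for s
    using norm_sq_quarter_turn_decomposition[OF v, of "s - p"] on[OF that] c
    by (simp add: dist_norm norm_minus_commute)
  obtain s where s: "s \<in> S" "0 \<le> (s - p) \<bullet> (c *\<^sub>R v - b *\<^sub>R ?J)" using sur by blast
  have "(s - p) \<bullet> ?J \<le> - c"
    using arc_below_chord[OF circle[OF s(1)] b0 c(1) b[OF s(1)]] s(2) by (simp add: inner_simps)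
  moreover obtain t where t: "t \<in> S" "0 \<le> (t - p) \<bullet> (c *\<^sub>R v + b *\<^sub>R ?J)" using sur by blast
  have "- ((t - p) \<bullet> ?J) \<le> - c"
    using arc_below_chord[OF _ b0 c(1) b[OF t(1)], of "- ((t - p) \<bullet> ?J)"] circle[OF t(1)] t(2)
    by (simp add: inner_add_right)
  ultimately have "2 * c \<le> (t - s) \<bullet> ?J" by (simp add: inner_simps)
  then have "(2 * c)\<^sup>2 \<le> ((t - s) \<bullet> ?J)\<^sup>2" using c by (intro power_mono) auto
  also have "\<dots> \<le> (norm (t - s))\<^sup>2"
    unfolding norm_sq_quarter_turn_decomposition[OF v, of "t - s", symmetric] by simp
  also have "\<dots> \<le> D\<^sup>2" using diam[OF t(1) s(1)] by (intro power_mono) (auto simp: dist_norm)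
  finally show ?thesis using c by (simp add: power_mult_distrib)
qed

text \<open>Jung's inequality in the plane follows from the previous bound with the height \<open>b = R / 2\<close>.
  If it failed, all points within distance \<open>D\<close> of a point \<open>s\<close> of the circle would be so close to \<open>s\<close>
  that, seen in the direction opposite to \<open>s\<close>, they have height less than \<open>R / 2\<close>; the bound then
  gives \<open>4 * (R\<^sup>2 - R\<^sup>2 / 4) \<le> D\<^sup>2\<close>, which is Jung's inequality itself.\<close>
lemma surrounding_points_Jung:
  fixes S :: "(real^2) set"
  assumes on: "\<And>s. s \<in> S \<Longrightarrow> dist p s = R"
    and sur: "\<And>w. \<exists>s\<in>S. 0 \<le> (s - p) \<bullet> w"
    and diam: "\<And>s t. s \<in> S \<Longrightarrow> t \<in> S \<Longrightarrow> dist s t \<le> D"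
  shows "3 * R\<^sup>2 \<le> D\<^sup>2"
proof (rule ccontr)
  assume n: "\<not> 3 * R\<^sup>2 \<le> D\<^sup>2"
  obtain s where s: "s \<in> S" using sur by blast
  have R: "R > 0" using on[OF s] n by (cases "R = 0") auto
  have s2: "norm (s - p) = R" using on[OF s] by (simp add: dist_norm norm_minus_commute)
  define v where "v = - ((s - p) /\<^sub>R R)"
  have "norm v = 1" using s2 R by (simp add: v_def)
  have "(t - p) \<bullet> v < R / 2" if t: "t \<in> S" for t
  proof -
    have t2: "norm (t - p) = R" using on[OF t] by (simp add: dist_norm norm_minus_commute)
    have "(norm ((s - p) - (t - p)))\<^sup>2 = (norm (s - p))\<^sup>2 + (norm (t - p))\<^sup>2 - 2 * ((s - p) \<bullet> (t - p))"
      by (simp only: dot_norm_neg) (simp add: field_simps)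
    then have "(norm (s - t))\<^sup>2 = 2 * R\<^sup>2 - 2 * ((t - p) \<bullet> (s - p))"
      by (simp add: s2 t2 inner_commute)
    moreover have "(norm (s - t))\<^sup>2 \<le> D\<^sup>2"
      using diam[OF s t] by (intro power_mono) (auto simp: dist_norm)
    ultimately have "- ((t - p) \<bullet> (s - p)) < R\<^sup>2 / 2" using n by simp
    then have "- ((t - p) \<bullet> (s - p)) / R < R\<^sup>2 / 2 / R" using R by (intro divide_strict_right_mono)
    moreover have "(t - p) \<bullet> v = - ((t - p) \<bullet> (s - p)) / R"
      unfolding v_def inner_minus_right inner_scaleR_right divide_inverse by (simp only: mult_minus_left mult.commute)
    moreover have "R\<^sup>2 / 2 / R = R / 2" using R by (simp add: power2_eq_square)
    ultimately show ?thesis by (simp only:)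
  qed
  from surrounding_points_chord_bound[OF on sur diam \<open>norm v = 1\<close> this]
  show False using n by (simp add: power_divide)
qed

text \<open>The constraints on a chord through the centre of the smallest enclosing disc. Both are
  inherited from the radius \<open>R\<close>, because \<open>a \<le> R\<close>. The first is then Jung's inequality. The second,
  which keeps the other half from being too short, comes from separating the point \<open>p - h *\<^sub>R u\<close> from
  \<open>Q\<close> for \<open>h > b\<close>: the separating line has distance at most \<open>h\<close> from \<open>p\<close>, and all contact points lie
  below it.\<close>
lemma chord_through_circumcenter:
  assumes Q: "convex_body Q"
    and far: "\<And>q. q \<in> Q \<Longrightarrow> dist p q \<le> R" and opt: "\<And>x. \<exists>q\<in>Q. R \<le> dist x q"
    and u: "norm u = 1" and chord: "{s. p + s *\<^sub>R u \<in> Q} = {- b..a}" and a: "a \<ge> 0" and b: "b \<ge> 0"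
  shows "3 * a\<^sup>2 \<le> (diameter Q)\<^sup>2" "4 * (a\<^sup>2 - b\<^sup>2) \<le> (diameter Q)\<^sup>2"
proof -
  define D where "D = diameter Q"
  have comp: "compact Q" and conv: "convex Q" and ne: "Q \<noteq> {}"
    using Q by (auto simp: convex_body_def)
  have D: "dist s t \<le> D" if "s \<in> Q" "t \<in> Q" for s t
    using comp that by (simp add: D_def compact_imp_bounded diameter_bounded_bound)
  define S where "S = {q \<in> Q. dist p q = R}"
  have S: "dist p s = R" "s \<in> Q" if "s \<in> S" for s using that by (auto simp: S_def)
  have sur: "\<exists>s\<in>S. 0 \<le> (s - p) \<bullet> w" for w
    using farthest_points_surround_optimum[OF comp ne far opt, of w] by (auto simp: S_def)
  have on: "p + s *\<^sub>R u \<in> Q \<longleftrightarrow> - b \<le> s \<and> s \<le> a" for s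
    using chord by (auto simp: set_eq_iff)
  have "p + a *\<^sub>R u \<in> Q" using a b on by auto
  from far[OF this] have aR: "a \<le> R" using u a by (simp add: dist_norm)
  then have a2: "a\<^sup>2 \<le> R\<^sup>2" using a by (intro power_mono)
  show "3 * a\<^sup>2 \<le> (diameter Q)\<^sup>2"
    using surrounding_points_Jung[of S p R D] S sur D a2 by (force simp: D_def)
  \<comment> \<open>A height strictly above \<open>b\<close> makes the separation strict; the bound at \<open>b\<close> is obtained as a limit.\<close>
  have Rh: "4 * (R\<^sup>2 - h\<^sup>2) \<le> D\<^sup>2" if h: "h > b" for h
  proof -
    have "p - h *\<^sub>R u \<notin> Q" using on[of "- h"] h by simp
    then obtain w r where w: "w \<bullet> (p - h *\<^sub>R u) < r" "\<And>x. x \<in> Q \<Longrightarrow> r < w \<bullet> x"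
      using separating_hyperplane_closed_point[OF conv compact_imp_closed[OF comp]] by blast
    have w0: "w \<noteq> 0" using w ne by force
    define v where "v = - (w /\<^sub>R norm w)"
    have v: "norm v = 1" using w0 by (simp add: v_def)
    have "(s - p) \<bullet> v < h" if s: "s \<in> S" for s
    proof -
      have "w \<bullet> (p - h *\<^sub>R u) < w \<bullet> s" using w(1) w(2)[OF S(2)[OF s]] by linarith
      then have "- (w \<bullet> (s - p)) < h * (w \<bullet> u)" by (simp add: inner_simps)
      also have "\<dots> \<le> h * norm w"
        using h b norm_cauchy_schwarz[of w u] u by (intro mult_left_mono) auto
      finally have "- (w \<bullet> (s - p)) / norm w < h * norm w / norm w"
        using w0 by (intro divide_strict_right_mono) auto
      then show ?thesis using w0 by (simp add: v_def inner_commute divide_inverse mult_ac)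
    qed
    from surrounding_points_chord_bound[OF S(1) sur _ v this] D S(2) show ?thesis by blast
  qed
  have "4 * (R\<^sup>2 - b\<^sup>2) \<le> D\<^sup>2"
  proof (rule tendsto_upperbound)
    show "((\<lambda>h. 4 * (R\<^sup>2 - h\<^sup>2)) \<longlongrightarrow> 4 * (R\<^sup>2 - b\<^sup>2)) (at_right b)"
      by (intro tendsto_intros)
    show "\<forall>\<^sub>F h in at_right b. 4 * (R\<^sup>2 - h\<^sup>2) \<le> D\<^sup>2"
      using Rh by (auto simp: eventually_at_filter)
  qed simp
  then show "4 * (a\<^sup>2 - b\<^sup>2) \<le> (diameter Q)\<^sup>2" using a2 by (simp add: D_def)
qed

section \<open>The cubic inequality for the two halves of a chord\<close>

text \<open>The constant is attained at \<open>a = t\<close> and \<open>b = 1 - t\<close> with \<open>t = sqrt 3 / 3\<close>: there the function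
  \<open>g x = x ^ 3 - K * x\<^sup>2\<close> satisfies \<open>g t + g (1 - t) = 0\<close>. Since \<open>g\<close> increases beyond \<open>K\<close>, the worst
  \<open>a\<close> for a given \<open>b\<close> is the largest one allowed, and which constraint determines it depends on \<open>b\<close>: for
  \<open>b \<ge> 1 - t\<close> it is \<open>a + b \<le> 1\<close>, for smaller \<open>b\<close> it is \<open>a \<le> t\<close>. When \<open>b\<close> is so small that
  \<open>g b > g (1 - t)\<close>, neither suffices and \<open>a\<^sup>2 \<le> b\<^sup>2 + 1 / 4\<close> takes over. The change is made at \<open>0.27\<close>,
  slightly above the point (about \<open>0.263\<close>) where the second case breaks down.\<close>
lemma cubic_chord_bound_unit:
  fixes a b K :: real
  assumes K: "K = 3 * (4 - sqrt 3) / 13" and b: "b \<ge> 0" and ab: "a + b \<le> 1"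
    and a3: "3 * a\<^sup>2 \<le> 1" and a4: "4 * (a\<^sup>2 - b\<^sup>2) \<le> 1" and aK: "a \<ge> K"
  shows "a ^ 3 + b ^ 3 \<le> K * (a\<^sup>2 + b\<^sup>2)"
proof -
  define t where "t = sqrt 3 / 3"
  have sq3: "sqrt 3 * sqrt 3 = (3::real)" by simp
  have "1.732 < sqrt (3::real)" by (rule real_less_rsqrt) (simp add: power2_eq_square)
  moreover have "sqrt (3::real) < 1.7321" by (rule real_less_lsqrt) (simp_all add: power2_eq_square)
  ultimately have s3: "1.732 < sqrt (3::real)" "sqrt (3::real) < 1.7321" .
  have Kb: "0.5233 < K" "K < 0.5235" and tb: "0.5773 < t" "t < 0.5774"
    using s3 by (auto simp: K t_def)
  have tt: "t\<^sup>2 = 1 / 3" by (simp add: t_def power2_eq_square)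
  have at: "a \<le> t" using a3 tt tb by (intro power2_le_imp_le[of a t]) auto
  define g where "g x = x ^ 3 - K * x\<^sup>2" for x :: real
  have g_mono: "g x \<le> g y" if "K \<le> x" "x \<le> y" for x y
  proof -
    have "x\<^sup>2 * (x - K) \<le> y\<^sup>2 * (y - K)"
      using that Kb by (intro mult_mono power_mono) auto
    then show ?thesis by (simp add: g_def algebra_simps power2_eq_square power3_eq_cube)
  qed
  have gsum: "g x + g (1 - x) = 1 - K - (3 - 2 * K) * (x * (1 - x))" for x
    by (simp add: g_def algebra_simps power2_eq_square power3_eq_cube)
  have gt: "g t + g (1 - t) = 0"
    unfolding gsum K t_def using sq3 by (simp add: field_simps)
  have "g a + g b \<le> 0"
  proof -
    consider "b \<ge> 1 - t" | "0.27 \<le> b" "b \<le> 1 - t" | "b \<le> 0.27" by linarith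
    then show ?thesis
    proof cases
      case 1
      have "g a \<le> g (1 - b)" using aK ab by (intro g_mono) auto
      moreover have "g (1 - b) + g b \<le> g t + g (1 - t)"
      proof -
        have "t * (1 - t) \<le> b * (1 - b)"
        proof -
          have "0 \<le> (b - (1 - t)) * (t - b)" 
            using 1 ab aK Kb tb by (intro mult_nonneg_nonneg) auto
          then show ?thesis by (simp add: algebra_simps)
        qed
        then have "(3 - 2 * K) * (t * (1 - t)) \<le> (3 - 2 * K) * (b * (1 - b))"
          using Kb by (intro mult_left_mono) auto
        then show ?thesis using gsum[of b] gsum[of t] by linarith
      qed
      ultimately show ?thesis using gt by linarith
    next
      case 2
      define m where "m = 1 - t"
      have m: "0.4226 < m" "m < 0.4227" using tb by (auto simp: m_def)
      have "g a \<le> g t" using aK at by (rule g_mono)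
      moreover have "g b \<le> g m"
      proof -
        have "(K - m) * (b + m) \<le> 0.1009 * (b + m)"
          using Kb m 2 by (intro mult_right_mono) auto
        also have "\<dots> \<le> 0.27 * b" using 2 m by simp
        also have "\<dots> \<le> b * b" using 2 by (intro mult_right_mono) auto
        finally have "0 \<le> b * b + b * m + m * m - K * (b + m)"
          by (simp add: algebra_simps)
        then have "0 \<le> (m - b) * (b * b + b * m + m * m - K * (b + m))"
          using 2 by (intro mult_nonneg_nonneg) (auto simp: m_def)
        then show ?thesis by (simp add: g_def algebra_simps power2_eq_square power3_eq_cube)
      qed
      ultimately show ?thesis using gt by (simp add: m_def)
    next
      case 3
      have "b\<^sup>2 \<le> 0.27\<^sup>2" using 3 b by (intro power_mono) auto
      then have b2: "b\<^sup>2 \<le> 0.0729" by (simp add: power2_eq_square)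
      \<comment> \<open>The right-hand side is a polynomial upper bound for \<open>sqrt (1 / 4 + b\<^sup>2)\<close>.\<close>
      have "a \<le> 1 / 2 + b\<^sup>2"
      proof (rule power2_le_imp_le)
        have "a\<^sup>2 \<le> 1 / 4 + b\<^sup>2" using a4 by simp
        also have "\<dots> \<le> (1 / 2 + b\<^sup>2)\<^sup>2" using zero_le_power2[of "b\<^sup>2"] by (simp add: power2_sum power_divide)
        finally show "a\<^sup>2 \<le> (1 / 2 + b\<^sup>2)\<^sup>2" .
      qed simp
      then have "a\<^sup>2 * (a - K) \<le> (1 / 4 + b\<^sup>2) * (1 / 2 + b\<^sup>2 - K)"
        using a4 aK by (intro mult_mono) auto
      then have "g a + g b \<le> b\<^sup>2 * (b\<^sup>2 + b + 3 / 4 - 2 * K) + 1 / 8 - K / 4"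
        by (simp add: g_def algebra_simps power2_eq_square power3_eq_cube)
      also have "\<dots> \<le> b\<^sup>2 * 0.0463 + 1 / 8 - K / 4"
        using b2 3 Kb by (intro diff_right_mono add_right_mono mult_left_mono) auto
      also have "\<dots> \<le> 0" using b2 Kb by simp
      finally show ?thesis .
    qed
  qed
  then show ?thesis by (simp add: g_def algebra_simps)
qed

text \<open>The scaled and symmetric form. If both halves are at most \<open>K * D\<close>, the inequality holds term by
  term; otherwise the longer half plays the part of \<open>a\<close> in the preceding lemma.\<close>
lemma cubic_chord_bound:
  fixes a b D :: real
  assumes a: "a \<ge> 0" and b: "b \<ge> 0" and D: "D > 0" and ab: "a + b \<le> D"
    and a3: "3 * a\<^sup>2 \<le> D\<^sup>2" and b3: "3 * b\<^sup>2 \<le> D\<^sup>2"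
    and a4: "4 * (a\<^sup>2 - b\<^sup>2) \<le> D\<^sup>2" and b4: "4 * (b\<^sup>2 - a\<^sup>2) \<le> D\<^sup>2"
  shows "2 * (a ^ 3 + b ^ 3) \<le> 3 * (2 * (4 - sqrt 3) / 13 * D) * (a\<^sup>2 + b\<^sup>2)"
proof -
  define K where "K = 3 * (4 - sqrt 3) / 13"
  define x y where "x = a / D" and "y = b / D"
  have aD: "a = D * x" and bD: "b = D * y" using D by (auto simp: x_def y_def)
  have D2: "D\<^sup>2 > 0" using D by simp
  have xy: "x \<ge> 0" "y \<ge> 0" "x + y \<le> 1" using a b D ab by (auto simp: x_def y_def field_simps)
  have "D\<^sup>2 * (3 * x\<^sup>2) \<le> D\<^sup>2 * 1" "D\<^sup>2 * (3 * y\<^sup>2) \<le> D\<^sup>2 * 1"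
    "D\<^sup>2 * (4 * (x\<^sup>2 - y\<^sup>2)) \<le> D\<^sup>2 * 1" "D\<^sup>2 * (4 * (y\<^sup>2 - x\<^sup>2)) \<le> D\<^sup>2 * 1"
    using a3 b3 a4 b4 by (simp_all add: aD bD power_mult_distrib algebra_simps)
  then have c: "3 * x\<^sup>2 \<le> 1" "3 * y\<^sup>2 \<le> 1" "4 * (x\<^sup>2 - y\<^sup>2) \<le> 1" "4 * (y\<^sup>2 - x\<^sup>2) \<le> 1"
    using D2 by (simp_all only: mult_le_cancel_left_pos)
  have "x ^ 3 + y ^ 3 \<le> K * (x\<^sup>2 + y\<^sup>2)"
  proof -
    consider "K \<le> x" | "K \<le> y" | "x \<le> K" "y \<le> K" by linarith
    then show ?thesis
    proof cases
      case 1
      then show ?thesis using cubic_chord_bound_unit[OF K_def] xy c by blast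
    next
      case 2
      then show ?thesis using cubic_chord_bound_unit[OF K_def, of x y] xy c by (simp add: add.commute)
    next
      case 3
      have "x * x\<^sup>2 \<le> K * x\<^sup>2" "y * y\<^sup>2 \<le> K * y\<^sup>2"
        using 3 by (auto intro: mult_right_mono)
      then show ?thesis by (simp add: algebra_simps power3_eq_cube power2_eq_square)
    qed
  qed
  then have "2 * D ^ 3 * (x ^ 3 + y ^ 3) \<le> 2 * D ^ 3 * (K * (x\<^sup>2 + y\<^sup>2))"
    using D by (intro mult_left_mono) auto
  then show ?thesis
    by (simp add: aD bD K_def power_mult_distrib power2_eq_square power3_eq_cube field_simps)
qed

section \<open>Upper bounds for the minimal average distance\<close>

lemma chord_length_le_diameter:
  fixes Q :: "'a::euclidean_space set"
  assumes "bounded Q" "norm u = 1" "{s. p + s *\<^sub>R u \<in> Q} = {- b..a}" "a \<ge> 0" "b \<ge> 0"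
  shows "a + b \<le> diameter Q"
proof -
  have "p + s *\<^sub>R u \<in> Q \<longleftrightarrow> - b \<le> s \<and> s \<le> a" for s
    using assms(3) by (auto simp: set_eq_iff)
  then have "p + a *\<^sub>R u \<in> Q" "p + (- b) *\<^sub>R u \<in> Q" using assms(4,5) by (auto simp del: scaleR_minus_left)
  then have "dist (p + a *\<^sub>R u) (p + (- b) *\<^sub>R u) \<le> diameter Q"
    by (intro diameter_bounded_bound assms(1))
  moreover have "(p + a *\<^sub>R u) - (p + (- b) *\<^sub>R u) = (a + b) *\<^sub>R u" by (simp add: algebra_simps)
  ultimately show ?thesis using assms(2,4,5) by (simp add: dist_norm)
qed

lemma min_avg_dist_le_of_chords:
  assumes "convex_body Q" "p \<in> Q" "k \<ge> 0"
    and "\<And>u a b. norm u = 1 \<Longrightarrow> a \<ge> 0 \<Longrightarrow> b \<ge> 0 \<Longrightarrow> {s. p + s *\<^sub>R u \<in> Q} = {- b..a} \<Longrightarrow>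
      2 * (a ^ 3 + b ^ 3) \<le> 3 * k * (a\<^sup>2 + b\<^sup>2)"
  shows "min_avg_dist Q \<le> k"
proof -
  have "min_avg_dist Q \<le> avg_dist Q p"
    by (rule min_avg_dist_attained[OF assms(1)]) blast
  also have "\<dots> \<le> k" using avg_dist_le_of_chords[OF assms] .
  finally show ?thesis .
qed

lemma diameter_convex_body_pos:
  assumes "convex_body Q"
  shows "diameter Q > 0"
proof -
  obtain x e where "e > 0" and e: "cball x e \<subseteq> Q"
    using assms by (auto simp: convex_body_def mem_interior_cball)
  moreover have "bounded Q" using assms by (simp add: convex_body_def compact_imp_bounded)
  ultimately show ?thesis
    using diameter_subset[OF e] by (simp add: diameter_cball)
qed

lemma min_avg_dist_le:
  assumes Q: "convex_body Q"
  shows "min_avg_dist Q \<le> 2 * (4 - sqrt 3) / 13 * diameter Q"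
proof -
  have comp: "compact Q" "convex Q" and ne: "Q \<noteq> {}"
    using Q by (auto simp: convex_body_def)
  note D = diameter_convex_body_pos[OF Q]
  obtain p R where far: "\<And>q. q \<in> Q \<Longrightarrow> dist p q \<le> R" and opt: "\<And>x. \<exists>q\<in>Q. R \<le> dist x q"
    using smallest_enclosing_ball_exists[OF comp(1) ne] by blast
  show ?thesis
  proof (rule min_avg_dist_le_of_chords[OF Q])
    show "p \<in> Q" using comp ne far opt by (rule smallest_enclosing_center_in)
    have "sqrt 3 \<le> (4::real)" by (rule real_le_lsqrt) auto
    then show "0 \<le> 2 * (4 - sqrt 3) / 13 * diameter Q" using D by simp
    fix u a b
    assume u: "norm u = 1" and a: "a \<ge> 0" and b: "b \<ge> 0"
      and chord: "{s. p + s *\<^sub>R u \<in> Q} = {- b..a}"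
    have mem: "p + s *\<^sub>R u \<in> Q \<longleftrightarrow> - b \<le> s \<and> s \<le> a" for s
      using chord by (auto simp: set_eq_iff)
    \<comment> \<open>The same chord traversed backwards exchanges \<open>a\<close> and \<open>b\<close>.\<close>
    have chord': "{s. p + s *\<^sub>R (- u) \<in> Q} = {- a..b}"
    proof -
      have "p + s *\<^sub>R (- u) \<in> Q \<longleftrightarrow> - a \<le> s \<and> s \<le> b" for s
        using mem[of "- s"] by auto
      then show ?thesis unfolding set_eq_iff mem_Collect_eq atLeastAtMost_iff by blast
    qed
    have u': "norm (- u) = 1" using u by simp
    show "2 * (a ^ 3 + b ^ 3) \<le> 3 * (2 * (4 - sqrt 3) / 13 * diameter Q) * (a\<^sup>2 + b\<^sup>2)"
      using chord_length_le_diameter[OF compact_imp_bounded[OF comp(1)] u chord a b]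
        chord_through_circumcenter[OF Q far opt u chord a b]
        chord_through_circumcenter[OF Q far opt u' chord' b a]
      by (intro cubic_chord_bound a b D)
  qed
qed

lemma min_avg_dist_centrally_symmetric_le:
  assumes Q: "convex_body Q" and sym: "centrally_symmetric Q"
  shows "min_avg_dist Q \<le> 1 / 3 * diameter Q"
proof -
  have comp: "compact Q" "convex Q" and ne: "Q \<noteq> {}"
    using Q by (auto simp: convex_body_def)
  obtain c where c: "\<And>q. q \<in> Q \<Longrightarrow> 2 *\<^sub>R c - q \<in> Q"
    using sym by (auto simp: centrally_symmetric_def)
  show ?thesis
  proof (rule min_avg_dist_le_of_chords[OF Q])
    obtain q where "q \<in> Q" using ne by auto
    then have "(1 / 2) *\<^sub>R q + (1 / 2) *\<^sub>R (2 *\<^sub>R c - q) \<in> Q"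
      using c by (intro convexD[OF comp(2)]) auto
    then show "c \<in> Q" by (simp add: algebra_simps)
    show "0 \<le> 1 / 3 * diameter Q" using diameter_convex_body_pos[OF Q] by simp
    fix u a b
    assume u: "norm u = 1" and a: "a \<ge> 0" and b: "b \<ge> 0"
      and chord: "{s. c + s *\<^sub>R u \<in> Q} = {- b..a}"
    have mem: "c + s *\<^sub>R u \<in> Q \<longleftrightarrow> - b \<le> s \<and> s \<le> a" for s
      using chord by (auto simp: set_eq_iff)
    have refl: "c + (- s) *\<^sub>R u \<in> Q" if "c + s *\<^sub>R u \<in> Q" for s
      using c[OF that] by (simp add: scaleR_2)
    have "a = b"
      using refl[of a] refl[of "- b"] a b unfolding mem by auto
    moreover have "a + b \<le> diameter Q"
      by (rule chord_length_le_diameter[OF compact_imp_bounded[OF comp(1)] u chord a b])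
    ultimately have "a\<^sup>2 * (4 * a) \<le> a\<^sup>2 * (2 * diameter Q)"
      by (intro mult_left_mono) auto
    then show "2 * (a ^ 3 + b ^ 3) \<le> 3 * (1 / 3 * diameter Q) * (a\<^sup>2 + b\<^sup>2)"
      using \<open>a = b\<close> by (simp add: power2_eq_square power3_eq_cube algebra_simps)
  qed
qed

theorem theorem2:
  fixes Q :: "(real^2) set"
  assumes "convex_body Q"
  shows "min_avg_dist Q \<le> 2 * (4 - sqrt 3) / 13 * diameter Q
    \<and> 2 * (4 - sqrt 3) / 13 * diameter Q < 0.3490 * diameter Q
    \<and> (centrally_symmetric Q \<longrightarrow> min_avg_dist Q \<le> 1 / 3 * diameter Q)"
proof (intro conjI impI)
  show "min_avg_dist Q \<le> 2 * (4 - sqrt 3) / 13 * diameter Q"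
    by (rule min_avg_dist_le[OF assms])
  have "1.7318 < sqrt (3::real)" by (rule real_less_rsqrt) (simp add: power2_eq_square)
  then have "2 * (4 - sqrt 3) / 13 < (0.3490::real)" by simp
  then show "2 * (4 - sqrt 3) / 13 * diameter Q < 0.3490 * diameter Q"
    by (intro mult_strict_right_mono diameter_convex_body_pos[OF assms])
  show "min_avg_dist Q \<le> 1 / 3 * diameter Q" if "centrally_symmetric Q"
    by (rule min_avg_dist_centrally_symmetric_le[OF assms that])
qed

end
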